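(* If $x\in[0,1)$ has (infinite) backward continued fraction expansion $x=[a_1,a_2,\dots]$, then the Minkowski Question Mark function satisfies $$?(x)=1-\sum_{j=1}^{\infty}\frac{1}{2^{-j+a_1+a_2+\dots+a_j}}=0.b_{a_1-2}b_{a_2-2}b_{a_3-2}\dots,$$ where the last expression is a binary expansion given by concatenation of the blocks $b_{a_i-2}$.
   Context: Backward continued fractions: for a sequence $(a_i)_{i\ge1}$ of integers $a_i\ge2$, write $$[a_1,a_2,a_3,\dots]=1-\cfrac{1}{a_1-\cfrac{1}{a_2-\cfrac{1}{a_3-\cdots}}}\in[0,1),$$ understood as the limit of the finite truncations. Every $x\in[0,1)$ has exactly one infinite expansion of this form with all $a_i\ge2$; for rational numbers (whose infinite expansion ends with a tail of $2$'s) the infinite expansion is always used. For $k\ge0$, $b_k$ is the binary block consisting of $k$ ones followed by a single $0$ (so $b_0=0$). The Minkowski Question Mark function $?:[0,1]\to[0,1]$ is the continuous strictly increasing function defined inductively on rationals by $?(0)=0$, $?(1)=1$ and $?\left(\frac{p+p'}{q+q'}\right)=\frac{?(p/q)+?(p'/q')}{2}$ whenever $p/q,p'/q'\in[0,1]$ are rationals in lowest terms with $p'q-pq'=1$, and extended to irrationals by continuity. *)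

theory Defs
  imports Complex_Main "HOL-Library.Stream" "HOL-Library.FuncSet"
begin

text \<open>Only the entries \<open>a i\<close> with \<open>i \<ge> 1\<close> of a sequence \<open>a\<close> matter.
  \<open>bcf_tail a i n\<close> is the finite continued fraction
  \<open>1 / (a i - 1 / (a (i+1) - \<dots> - 1 / a (i+n-1)))\<close>; for \<open>n = 0\<close> it is \<open>0\<close>.\<close>

fun bcf_tail :: "(nat \<Rightarrow> int) \<Rightarrow> nat \<Rightarrow> nat \<Rightarrow> real" where
  "bcf_tail a i 0 = 0"
| "bcf_tail a i (Suc n) = 1 / (of_int (a i) - bcf_tail a (Suc i) n)"

definition bcf_truncation :: "(nat \<Rightarrow> int) \<Rightarrow> nat \<Rightarrow> real" where
  "bcf_truncation a n = 1 - bcf_tail a 1 n"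

definition has_bcf_expansion :: "real \<Rightarrow> (nat \<Rightarrow> int) \<Rightarrow> bool" where
  "has_bcf_expansion x a \<longleftrightarrow> (\<forall>i\<ge>1. a i \<ge> 2) \<and> bcf_truncation a \<longlonglongrightarrow> x"

text \<open>Membership in \<open>{0..1} \<rightarrow>\<^sub>E {0..1}\<close> fixes the values outside \<open>[0,1]\<close> to \<open>undefined\<close>,
  so that the properties below determine a function on all of \<open>\<real>\<close> uniquely.
  The bounds \<open>p \<le> q\<close> and \<open>0 \<le> p'\<close> follow from the determinant condition.\<close>

definition is_question_mark :: "(real \<Rightarrow> real) \<Rightarrow> bool" where
  "is_question_mark f \<longleftrightarrow>
     f \<in> {0..1} \<rightarrow>\<^sub>E {0..1} \<and>
     continuous_on {0..1} f \<and>
     strict_mono_on {0..1} f \<and>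
     f 0 = 0 \<and> f 1 = 1 \<and>
     (\<forall>p q p' q' :: int.
        q > 0 \<and> q' > 0 \<and> coprime p q \<and> coprime p' q' \<and> 0 \<le> p \<and> p' \<le> q' \<and>
        p' * q - p * q' = 1 \<longrightarrow>
        f (of_int (p + p') / of_int (q + q')) =
          (f (of_int p / of_int q) + f (of_int p' / of_int q')) / 2)"

definition question_mark :: "real \<Rightarrow> real" where
  "question_mark = (THE f. is_question_mark f)"

definition block :: "nat \<Rightarrow> nat list" where
  "block k = replicate k 1 @ [0]"

text \<open>The infinite word \<open>b\<^bsub>a 1 - 2\<^esub> b\<^bsub>a 2 - 2\<^esub> b\<^bsub>a 3 - 2\<^esub> \<dots>\<close>. The stream function
  \<^const>\<open>flat\<close> requires nonempty words, which blocks always are.\<close>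

definition bcf_digits :: "(nat \<Rightarrow> int) \<Rightarrow> nat stream" where
  "bcf_digits a = flat (smap (\<lambda>i. block (nat (a i - 2))) (fromN 1))"

definition has_binary_expansion :: "real \<Rightarrow> nat stream \<Rightarrow> bool" where
  "has_binary_expansion y d \<longleftrightarrow>
     sset d \<subseteq> {0, 1} \<and> (\<lambda>n. real (d !! n) / 2 ^ Suc n) sums y"

end

theory Submission
  imports Defs "HOL-Analysis.Analysis"
begin

text \<open>The maps \<open>y \<mapsto> y / (1 + y)\<close> and \<open>y \<mapsto> 1 / (2 - y)\<close> send \<open>[0,1]\<close> onto its two halves and
  preserve Farey pairs, so the question mark function conjugates them to prepending a binary digit
  \<open>0\<close> or \<open>1\<close>. It is the fixed point of a contraction expressing this, and it is determined by its
  values at rationals because every reduced fraction in \<open>(0,1)\<close> is a mediant. Removing the first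
  entry \<open>a\<close> of a backward continued fraction undoes \<open>a - 2\<close> right branches and one left branch;
  hence \<open>1 - ?\<close>, the partial sums of the series, and \<open>1\<close> minus the value of the digit stream all
  obey \<open>W = 2\<^sup>1\<^sup>-\<^sup>a (1 + W')\<close>. The partial sums are exactly \<open>1 - ?\<close> at the truncations, and the claim
  follows by continuity.\<close>

section \<open>The fixed point of the Farey operator\<close>

text \<open>The arguments \<open>x / (1 - x)\<close> and \<open>2 - 1/x\<close> invert the two
  branch maps. At \<open>x = 1/2\<close> they are \<open>1\<close> and \<open>0\<close>, so both
  formulas give \<open>1/2\<close> when \<open>g 0 = 0\<close> and \<open>g 1 = 1\<close>.\<close>

definition farey_step :: "(real \<Rightarrow> real) \<Rightarrow> real \<Rightarrow> real" where
  "farey_step g x = (if x \<le> 1/2 then g (x / (1 - x)) / 2 else (1 + g (2 - 1/x)) / 2)"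

text \<open>Monotonicity is only weak because strictness would be lost in the limit; it is recovered
  separately for the fixed point.\<close>

definition admissible :: "(real \<Rightarrow> real) \<Rightarrow> bool" where
  "admissible g \<longleftrightarrow> continuous_on {0..1} g \<and> mono_on {0..1} g \<and> g 0 = 0 \<and> g 1 = 1"

lemma left_inverse_in_unit: "0 \<le> x \<Longrightarrow> x \<le> 1/2 \<Longrightarrow> x / (1 - x) \<in> {0..1::real}"
  by (auto simp: field_simps)

lemma right_inverse_in_unit: "1/2 \<le> x \<Longrightarrow> x \<le> 1 \<Longrightarrow> 2 - 1/x \<in> {0..1::real}"
  by (auto simp: field_simps)

lemma left_inverse_mono: "0 \<le> x \<Longrightarrow> x \<le> y \<Longrightarrow> y \<le> 1/2 \<Longrightarrow> x / (1 - x) \<le> y / (1 - y::real)"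
  by (rule frac_le) auto

lemma right_inverse_mono: "1/2 \<le> x \<Longrightarrow> x \<le> y \<Longrightarrow> 2 - 1/x \<le> 2 - 1/(y::real)"
  by (auto simp: field_simps)

lemma admissible_range:
  assumes "admissible g" "x \<in> {0..1}"
  shows "g x \<in> {0..1}"
proof -
  have "g 0 \<le> g x" "g x \<le> g 1"
    using assms mono_onD[of "{0..1}" g] unfolding admissible_def by force+
  with assms show ?thesis by (simp add: admissible_def)
qed

text \<open>The two pieces agree at \<open>1/2\<close>, which gives continuity. Values on the left
  half are at most \<open>1/2\<close> and those on the right half at least \<open>1/2\<close>, which
  gives monotonicity across the midpoint.\<close>

lemma admissible_farey_step:
  assumes "admissible g"
  shows "admissible (farey_step g)"
proof -
  have c: "continuous_on {0..1} g" and m: "mono_on {0..1} g" and g0: "g 0 = 0" and g1: "g 1 = 1"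
    using assms by (auto simp: admissible_def)
  have "continuous_on ({0..1/2} \<union> {1/2..1}) (farey_step g)"
    unfolding farey_step_def
  proof (rule continuous_on_If)
    show "continuous_on {0..1/2} (\<lambda>x. g (x / (1 - x)) / 2)"
      by (intro continuous_intros continuous_on_compose2[OF c])
         (use left_inverse_in_unit in auto)
    show "continuous_on {1/2..1} (\<lambda>x. (1 + g (2 - 1/x)) / 2)"
      by (intro continuous_intros continuous_on_compose2[OF c])
         (use right_inverse_in_unit in auto)
  next
    fix x :: real assume "x \<in> {1/2..1}" "x \<le> 1/2"
    then have x: "x = 1/2" by simp
    show "g (x / (1 - x)) / 2 = (1 + g (2 - 1/x)) / 2" unfolding x by (simp add: g0 g1)
  qed auto
  moreover have "{0..1/2} \<union> {1/2..1} = {0..1::real}" by auto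
  moreover have "mono_on {0..1} (farey_step g)"
  proof (rule mono_onI)
    fix x y :: real assume xy: "x \<in> {0..1}" "y \<in> {0..1}" "x \<le> y"
    consider "y \<le> 1/2" | "x \<le> 1/2" "1/2 < y" | "1/2 < x" using xy by linarith
    then show "farey_step g x \<le> farey_step g y"
    proof cases
      case 1
      then have "g (x / (1 - x)) \<le> g (y / (1 - y))"
        using xy by (intro mono_onD[OF m] left_inverse_in_unit left_inverse_mono) auto
      then show ?thesis using 1 xy by (simp add: farey_step_def)
    next
      case 2
      have "g (x / (1 - x)) \<le> 1" "0 \<le> g (2 - 1/y)"
        using admissible_range[OF assms left_inverse_in_unit, of x]
          admissible_range[OF assms right_inverse_in_unit, of y] 2 xy by auto
      then show ?thesis using 2 by (simp add: farey_step_def)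
    next
      case 3
      then have "g (2 - 1/x) \<le> g (2 - 1/y)"
        using xy by (intro mono_onD[OF m] right_inverse_in_unit right_inverse_mono) auto
      then show ?thesis using 3 xy by (simp add: farey_step_def)
    qed
  qed
  ultimately show ?thesis by (simp add: admissible_def farey_step_def g0 g1)
qed

section \<open>Uniform convergence of the iterates started at the identity\<close>

lemma admissible_funpow_farey_step: "admissible ((farey_step ^^ n) id)"
proof (induction n)
  case 0
  show ?case by (simp add: admissible_def mono_on_def)
next
  case (Suc n)
  then show ?case by (simp add: admissible_farey_step)
qed

text \<open>Each branch halves differences of values and evaluates \<open>g\<close> and
  \<open>h\<close> at the same point of the unit interval.\<close>

lemma farey_step_contraction:
  assumes "\<And>x. x \<in> {0..1} \<Longrightarrow> \<bar>g x - h x\<bar> \<le> c" and "x \<in> {0..1}"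
  shows "\<bar>farey_step g x - farey_step h x\<bar> \<le> c / 2"
proof (cases "x \<le> 1/2")
  case True
  then show ?thesis
    using assms(1)[OF left_inverse_in_unit, of x] assms(2)
    by (simp add: farey_step_def flip: diff_divide_distrib)
next
  case False
  then show ?thesis
    using assms(1)[OF right_inverse_in_unit, of x] assms(2)
    by (simp add: farey_step_def flip: diff_divide_distrib)
qed

lemma funpow_farey_step_diff:
  "x \<in> {0..1} \<Longrightarrow> \<bar>(farey_step ^^ Suc n) id x - (farey_step ^^ n) id x\<bar> \<le> (1/2) ^ n"
proof (induction n arbitrary: x)
  case 0
  then show ?case
    using admissible_range[OF admissible_funpow_farey_step[of 1] 0] by (simp add: id_def) linarith
next
  case (Suc n)
  have "\<bar>farey_step ((farey_step ^^ Suc n) id) x - farey_step ((farey_step ^^ n) id) x\<bar> \<le> (1/2) ^ n / 2"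
    using Suc by (intro farey_step_contraction)
  then show ?case by (simp only: funpow.simps o_apply power_Suc mult.commute times_divide_eq_right mult_1_right)
qed

definition farey_limit :: "real \<Rightarrow> real" where
  "farey_limit x = lim (\<lambda>n. (farey_step ^^ n) id x)"

lemma uniform_limit_farey_limit:
  "uniform_limit {0..1} (\<lambda>n. (farey_step ^^ n) id) farey_limit sequentially"
proof -
  let ?d = "\<lambda>n x. (farey_step ^^ Suc n) id x - (farey_step ^^ n) id x"
  have "uniform_limit {0..1} (\<lambda>n x. \<Sum>i<n. ?d i x) (\<lambda>x. suminf (\<lambda>i. ?d i x)) sequentially"
    by (rule Weierstrass_m_test[where M = "\<lambda>n. (1/2) ^ n"])
       (use funpow_farey_step_diff in \<open>auto simp: summable_geometric\<close>)
  \<comment> \<open>The zeroth iterate is \<open>x\<close>, so adding it turns the telescoping sum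
    into the \<open>n\<close>-th iterate.\<close>
  then have "uniform_limit {0..1} (\<lambda>n x. (\<Sum>i<n. ?d i x) + x) (\<lambda>x. suminf (\<lambda>i. ?d i x) + x) sequentially"
    by (intro uniform_limit_intros)
  moreover have "(\<Sum>i<n. ?d i x) + x = (farey_step ^^ n) id x" for n x
    by (subst sum_lessThan_telescope) simp
  ultimately have ul: "uniform_limit {0..1} (\<lambda>n. (farey_step ^^ n) id) (\<lambda>x. suminf (\<lambda>i. ?d i x) + x) sequentially"
    by simp
  moreover have "farey_limit x = suminf (\<lambda>i. ?d i x) + x" if "x \<in> {0..1}" for x
    unfolding farey_limit_def using tendsto_uniform_limitI[OF ul that] by (rule limI)
  ultimately show ?thesis
    by (metis (no_types, lifting) uniform_limit_cong')
qed

lemma farey_limit_tendsto: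
  "x \<in> {0..1} \<Longrightarrow> (\<lambda>n. (farey_step ^^ n) id x) \<longlonglongrightarrow> farey_limit x"
  by (rule tendsto_uniform_limitI[OF uniform_limit_farey_limit])

lemma admissible_farey_limit: "admissible farey_limit"
  unfolding admissible_def
proof (intro conjI mono_onI)
  show "continuous_on {0..1} farey_limit"
    by (rule uniform_limit_theorem[OF _ uniform_limit_farey_limit])
       (use admissible_funpow_farey_step in \<open>auto simp: admissible_def\<close>)
next
  fix x y :: real assume xy: "x \<in> {0..1}" "y \<in> {0..1}" "x \<le> y"
  have "(farey_step ^^ n) id x \<le> (farey_step ^^ n) id y" for n
    using admissible_funpow_farey_step[of n] xy by (auto simp: admissible_def intro: mono_onD)
  then show "farey_limit x \<le> farey_limit y"
    using xy by (intro LIMSEQ_le[OF farey_limit_tendsto farey_limit_tendsto]) auto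
next
  show "farey_limit 0 = 0" "farey_limit 1 = 1"
    using admissible_funpow_farey_step farey_limit_tendsto[of 0] farey_limit_tendsto[of 1]
    by (simp_all add: admissible_def LIMSEQ_const_iff)
qed

lemma farey_limit_fixed_point:
  assumes "x \<in> {0..1}"
  shows "farey_limit x = farey_step farey_limit x"
proof (rule LIMSEQ_unique)
  show "(\<lambda>n. (farey_step ^^ Suc n) id x) \<longlonglongrightarrow> farey_limit x"
    using farey_limit_tendsto[OF assms] by (rule LIMSEQ_Suc)
  show "(\<lambda>n. (farey_step ^^ Suc n) id x) \<longlonglongrightarrow> farey_step farey_limit x"
  proof (cases "x \<le> 1/2")
    case True
    then have "(\<lambda>n. (farey_step ^^ n) id (x / (1 - x)) / 2) \<longlonglongrightarrow> farey_limit (x / (1 - x)) / 2"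
      using assms by (intro tendsto_intros farey_limit_tendsto left_inverse_in_unit) auto
    then show ?thesis using True by (simp add: farey_step_def)
  next
    case False
    then have "(\<lambda>n. (1 + (farey_step ^^ n) id (2 - 1/x)) / 2) \<longlonglongrightarrow> (1 + farey_limit (2 - 1/x)) / 2"
      using assms by (intro tendsto_intros farey_limit_tendsto right_inverse_in_unit) auto
    then show ?thesis using False by (simp add: farey_step_def)
  qed
qed

section \<open>Functional equations of the limit on the two halves\<close>

lemma farey_limit_left: "0 \<le> x \<Longrightarrow> x \<le> 1/2 \<Longrightarrow> farey_limit x = farey_limit (x / (1 - x)) / 2"
  using farey_limit_fixed_point[of x] by (simp add: farey_step_def)

lemma farey_limit_right:
  assumes "1/2 \<le> x" "x \<le> 1"
  shows "farey_limit x = (1 + farey_limit (2 - 1/x)) / 2"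
proof (cases "x = 1/2")
  \<comment> \<open>The operator uses its left branch at \<open>1/2\<close>, so agreement with the
    right formula comes from the end values \<open>0\<close> and \<open>1\<close>.\<close>
  case True
  show ?thesis
    using farey_limit_fixed_point[of "1/2"] admissible_farey_limit
    unfolding True by (simp add: farey_step_def admissible_def)
next
  case False
  then show ?thesis
    using farey_limit_fixed_point[of x] assms by (simp add: farey_step_def)
qed

lemma farey_limit_half: "farey_limit (1/2) = 1/2"
  using farey_limit_left[of "1/2"] admissible_farey_limit by (simp add: admissible_def)

section \<open>The fixed point is the question mark function\<close>

text \<open>The inverse branches expand distances, so the least \<open>w\<close> with value \<open>1\<close>
  would be moved further left by the right one unless \<open>w = 1\<close>.\<close>

lemma farey_limit_eq_1:
  assumes "w \<in> {0..1}" "farey_limit w = 1"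
  shows "w = 1"
proof -
  have c: "continuous_on {0..1} farey_limit" and m: "mono_on {0..1} farey_limit"
    using admissible_farey_limit by (auto simp: admissible_def)
  let ?K = "{x \<in> {0..1}. farey_limit x = 1}"
  have "closed ?K" by (intro continuous_closed_preimage_constant c) auto
  then have "compact ?K"
    by (metis (no_types, lifting) bounded_closed_interval bounded_subset compact_eq_bounded_closed
        mem_Collect_eq subsetI)
  with assms obtain s where s: "s \<in> ?K" "\<And>x. x \<in> ?K \<Longrightarrow> s \<le> x"
    using compact_attains_inf[of ?K] by blast
  have half: "1/2 < s"
  proof (rule ccontr)
    assume "\<not> 1/2 < s"
    then have "farey_limit s \<le> farey_limit (1/2)" using s by (intro mono_onD[OF m]) auto
    then show False using s farey_limit_half by simp
  qed
  then have "2 - 1/s \<in> ?K"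
    using s(1) farey_limit_right[of s] right_inverse_in_unit[of s] by auto
  then have "s \<le> 2 - 1/s" by (rule s(2))
  then have "(s - 1)\<^sup>2 \<le> 0" using half by (simp add: field_simps power2_eq_square)
  then have "s = 1" by simp
  then show ?thesis using s(2)[of w] assms by auto
qed

text \<open>An interval of constancy of maximal length would be mapped by an inverse branch to a longer one.\<close>

lemma strict_mono_on_farey_limit: "strict_mono_on {0..1} farey_limit"
proof -
  have c: "continuous_on {0..1} farey_limit" and m: "mono_on {0..1} farey_limit"
    using admissible_farey_limit by (auto simp: admissible_def)
  let ?S = "{0..1::real} \<times> {0..1::real}"
  let ?K = "{z \<in> ?S. farey_limit (fst z) - farey_limit (snd z) = 0}"
  have "continuous_on ?S (\<lambda>z. farey_limit (fst z) - farey_limit (snd z))"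
    by (intro continuous_intros continuous_on_compose2[OF c]) auto
  then have "closed ?K"
    by (intro continuous_closed_preimage_constant closed_Times) auto
  moreover have "bounded ?K"
    by (rule bounded_subset[of ?S]) (auto intro: bounded_Times)
  ultimately have "compact ?K" by (simp add: compact_eq_bounded_closed)
  moreover have "(0, 0) \<in> ?K" by simp
  then have "?K \<noteq> {}" by blast
  moreover have "continuous_on ?K (\<lambda>z. snd z - fst z)" by (intro continuous_intros)
  ultimately obtain z where z: "z \<in> ?K" "\<And>w. w \<in> ?K \<Longrightarrow> snd w - fst w \<le> snd z - fst z"
    using continuous_attains_sup[of ?K "\<lambda>z. snd z - fst z"] by blast
  define u v where "u = fst z" and "v = snd z"
  have uv: "u \<in> {0..1}" "v \<in> {0..1}" "farey_limit u = farey_limit v"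
    using z(1) by (auto simp: u_def v_def)
  have longest: "y - x \<le> v - u" if "x \<in> {0..1}" "y \<in> {0..1}" "farey_limit x = farey_limit y" for x y
    using z(2)[of "(x, y)"] that by (simp add: u_def v_def)
  \<comment> \<open>Since \<open>v - u\<close> is the greatest length of an interval of constancy,
    this excludes every nondegenerate one.\<close>
  have "v \<le> u"
  proof (rule ccontr)
    assume "\<not> v \<le> u"
    then have lt: "u < v" by simp
    consider "v \<le> 1/2" | "u < 1/2" "1/2 < v" | "1/2 \<le> u" by linarith
    then show False
    proof cases
      case 1
      have uv0: "0 \<le> u" "0 \<le> v" "u \<le> 1/2" using 1 uv(1,2) lt by auto
      have "farey_limit (u / (1 - u)) = farey_limit (v / (1 - v))"
        using farey_limit_left[OF uv0(1,3)] farey_limit_left[OF uv0(2) 1] uv(3) by linarith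
      then have "v / (1 - v) - u / (1 - u) \<le> v - u"
        using 1 uv0 by (intro longest left_inverse_in_unit)
      \<comment> \<open>The left inverse stretches the interval by
        \<open>1 / ((1 - v) * (1 - u))\<close>, which exceeds \<open>1\<close>.\<close>
      moreover have "v / (1 - v) - u / (1 - u) = (v - u) / ((1 - v) * (1 - u))"
        using 1 lt by (simp add: field_simps)
      moreover have "(1 - v) * (1 - u) < 1 * 1"
        using 1 lt uv0 by (intro mult_less_le_imp_less) auto
      moreover have "0 < (1 - v) * (1 - u)" using 1 lt by simp
      ultimately show False using lt
        by (simp add: divide_le_eq)
    next
      case 2
      \<comment> \<open>Monotonicity forces the common value to be \<open>1/2\<close>. The left
        inverse then sends \<open>u\<close> to a point of value \<open>1\<close>, which can only be
        \<open>1\<close>, so \<open>u\<close> would be \<open>1/2\<close>.\<close>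
      have "farey_limit u \<le> farey_limit (1/2)" "farey_limit (1/2) \<le> farey_limit v"
        using 2 uv(1,2) by (auto intro!: mono_onD[OF m])
      then have "farey_limit u = 1/2" using uv farey_limit_half by linarith
      moreover have u0: "0 \<le> u" "u \<le> 1/2" using 2 uv(1) by auto
      ultimately have "farey_limit (u / (1 - u)) = 1"
        using farey_limit_left[OF u0] by linarith
      with left_inverse_in_unit[OF u0] have "u / (1 - u) = 1" by (rule farey_limit_eq_1)
      then show False using 2 by (simp add: field_simps)
    next
      case 3
      have uv1: "u \<le> 1" "v \<le> 1" "1/2 \<le> v" using 3 uv(1,2) lt by auto
      have "farey_limit (2 - 1/u) = farey_limit (2 - 1/v)"
        using farey_limit_right[OF 3 uv1(1)] farey_limit_right[OF uv1(3,2)] uv(3)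
        by (metis add_left_cancel divide_cancel_right zero_neq_numeral)
      then have "(2 - 1/v) - (2 - 1/u) \<le> v - u"
        using 3 uv1 by (intro longest right_inverse_in_unit)
      \<comment> \<open>The right inverse stretches the interval by
        \<open>1 / (v * u)\<close>.\<close>
      moreover have "(2 - 1/v) - (2 - 1/u) = (v - u) / (v * u)"
        using 3 lt by (simp add: field_simps)
      moreover have "u * v < 1 * 1"
        using 3 lt uv1 by (intro mult_less_le_imp_less) auto
      moreover have "0 < u * v" using 3 lt by simp
      ultimately show False using lt
        by (simp add: divide_le_eq mult.commute)
    qed
  qed
  show ?thesis
  proof (rule strict_mono_onI)
    fix x y :: real assume xy: "x \<in> {0..1}" "y \<in> {0..1}" "x < y"
    have "farey_limit x \<noteq> farey_limit y"
      using longest[of x y] xy \<open>v \<le> u\<close> by auto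
    then show "farey_limit x < farey_limit y"
      using mono_onD[OF m, of x y] xy by simp
  qed
qed

section \<open>The mediant rule and existence\<close>

text \<open>The inverse branches act linearly on fractions, by \<open>(p, q)\<close> to
  \<open>(p, q - p)\<close> and by \<open>(p, q)\<close> to \<open>(2 * p - q, p)\<close>, both with
  determinant \<open>1\<close>. They carry Farey pairs and their mediants to such with smaller
  denominator sum, until only \<open>0/1\<close> and \<open>1/1\<close> are left.\<close>

lemma farey_limit_mediant:
  fixes p q p' q' :: int
  assumes "0 < q" "0 < q'" "0 \<le> p" "p' \<le> q'" "p' * q - p * q' = 1"
  shows "farey_limit (of_int (p + p') / of_int (q + q')) =
    (farey_limit (of_int p / of_int q) + farey_limit (of_int p' / of_int q')) / 2"
  using assms
proof (induction "nat (q + q')" arbitrary: p q p' q' rule: less_induct)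
  case less
  have q: "0 < q" "0 < q'" "0 \<le> p" "p' \<le> q'" and det: "p' * q - p * q' = 1"
    using less.prems by auto
  have "0 \<le> p * q'" using q by simp
  then have "0 < p' * q" using det by linarith
  then have p': "0 < p'" using q by (simp add: zero_less_mult_iff)
  have "p' * q \<le> q' * q" using q by (intro mult_right_mono) auto
  then have "p * q' < q * q'" using det by (simp add: mult.commute)
  then have pq: "p < q" using q by simp
  \<comment> \<open>The pair lies in the left half, in the right half, or has \<open>1/2\<close>
    strictly between its members.\<close>
  consider "2 * p' \<le> q'" | "q \<le> 2 * p" | "2 * p < q" "q' < 2 * p'" by linarith
  then show ?case
  proof cases
    case 1
    have lt: "2 * p < q"
    proof (rule ccontr)
      assume "\<not> 2 * p < q"
      then have "q * q' \<le> (2 * p) * q'" using q by (intro mult_right_mono) auto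
      moreover have "(2 * p') * q \<le> q' * q" using q 1 by (intro mult_right_mono) auto
      ultimately show False using det by (simp add: algebra_simps)
    qed
    have IH: "farey_limit (of_int (p + p') / of_int ((q - p) + (q' - p'))) =
      (farey_limit (of_int p / of_int (q - p)) + farey_limit (of_int p' / of_int (q' - p'))) / 2"
      using q p' pq 1 lt det by (intro less.hyps) (auto simp: algebra_simps)
    have *: "farey_limit (of_int r / of_int s) = farey_limit (of_int r / of_int (s - r)) / 2"
      if "0 \<le> r" "2 * r \<le> s" "0 < s" for r s :: int
    proof -
      have "real_of_int r / of_int s \<le> 1/2"
        using that by (simp add: field_simps flip: of_int_le_iff)
      moreover have "real_of_int r / of_int s / (1 - of_int r / of_int s) = of_int r / of_int (s - r)"
      proof -
        have "1 - real_of_int r / of_int s = of_int (s - r) / of_int s"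
          using that by (simp add: field_simps)
        then show ?thesis using that by simp
      qed
      ultimately show ?thesis
        using farey_limit_left[of "of_int r / of_int s"] that(1,3) by (metis divide_nonneg_pos of_int_0_le_iff of_int_0_less_iff)
    qed
    show ?thesis
      using *[of p q] *[of p' q'] *[of "p + p'" "q + q'"] IH q p' 1 lt by (simp add: algebra_simps)
  next
    case 2
    have lt: "q' < 2 * p'"
    proof (rule ccontr)
      assume "\<not> q' < 2 * p'"
      then have "(2 * p') * q \<le> q' * q" using q by (intro mult_right_mono) auto
      moreover have "q * q' \<le> (2 * p) * q'" using q 2 by (intro mult_right_mono) auto
      ultimately show False using det by (simp add: algebra_simps)
    qed
    have IH: "farey_limit (of_int ((2 * p - q) + (2 * p' - q')) / of_int (p + p')) =
      (farey_limit (of_int (2 * p - q) / of_int p) + farey_limit (of_int (2 * p' - q') / of_int p')) / 2"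
      using q p' pq 2 lt det by (intro less.hyps) (auto simp: algebra_simps)
    have *: "farey_limit (of_int r / of_int s) = (1 + farey_limit (of_int (2 * r - s) / of_int r)) / 2"
      if "r \<le> s" "s \<le> 2 * r" "0 < s" for r s :: int
    proof -
      have "real_of_int s \<le> 2 * of_int r" using that by (simp flip: of_int_le_iff)
      then have "1/2 \<le> real_of_int r / of_int s"
        using that by (simp add: field_simps)
      moreover have "2 - 1 / (real_of_int r / of_int s) = of_int (2 * r - s) / of_int r"
        using that by (simp add: field_simps)
      ultimately show ?thesis
        using farey_limit_right[of "of_int r / of_int s"] that by (metis divide_le_eq_1_pos of_int_0_less_iff of_int_le_iff)
    qed
    show ?thesis
      using *[of p q] *[of p' q'] *[of "p + p'" "q + q'"] IH q p' pq 2 lt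
      by (simp add: algebra_simps add_divide_distrib)
  next
    case 3
    \<comment> \<open>This is twice the determinant. Both factors in parentheses are positive
      integers, so \<open>q + q' \<le> 2\<close>.\<close>
    have "(q - 2 * p) * q' + (2 * p' - q') * q = 2" using det by (simp add: algebra_simps)
    moreover have "1 * q' \<le> (q - 2 * p) * q'" "1 * q \<le> (2 * p' - q') * q"
      using 3 q by (intro mult_right_mono; simp)+
    ultimately have "q = 1" "q' = 1" using q by linarith+
    with 3 q have "p = 0" "p' = 1" by linarith+
    with \<open>q = 1\<close> \<open>q' = 1\<close> show ?thesis
      using farey_limit_half admissible_farey_limit by (simp add: admissible_def)
  qed
qed

text \<open>The determinant condition puts both fractions and their mediant in the unit interval,
  where the restriction changes nothing.\<close>

lemma is_question_mark_farey_limit: "is_question_mark (restrict farey_limit {0..1})"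
proof -
  let ?f = "restrict farey_limit {0..1}"
  have adm: "continuous_on {0..1} farey_limit" "farey_limit 0 = 0" "farey_limit 1 = 1"
    using admissible_farey_limit by (auto simp: admissible_def)
  have "?f (of_int (p + p') / of_int (q + q')) = (?f (of_int p / of_int q) + ?f (of_int p' / of_int q')) / 2"
    if h: "0 < q" "0 < q'" "0 \<le> p" "p' \<le> q'" "p' * q - p * q' = 1" for p q p' q' :: int
  proof -
    have "p' * q \<le> q' * q" using h by (intro mult_right_mono) auto
    then have "p * q' < q * q'" using h(5) by (simp add: mult.commute)
    then have pq: "p < q" using h(2) by simp
    have "0 \<le> p * q'" using h by simp
    then have "0 < p' * q" using h by linarith
    then have "0 < p'" using h by (simp add: zero_less_mult_iff)
    then show ?thesis using h pq farey_limit_mediant[OF h]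
      by (simp add: divide_le_eq flip: of_int_add)
  qed
  moreover have "?f \<in> {0..1} \<rightarrow>\<^sub>E {0..1}"
    using admissible_range[OF admissible_farey_limit] by auto
  moreover have "continuous_on {0..1} ?f"
    using adm(1) continuous_on_cong[of "{0..1}" "{0..1}" ?f farey_limit] by simp
  moreover have "strict_mono_on {0..1} ?f"
    using strict_mono_on_farey_limit by (auto simp: strict_mono_on_def)
  ultimately show ?thesis
    unfolding is_question_mark_def using adm(2,3) by simp
qed

section \<open>Uniqueness of the question mark function\<close>

text \<open>The denominator of the left parent is the inverse of \<open>p\<close> modulo
  \<open>q\<close>, found by Bezout; the right parent is what remains.\<close>

lemma farey_parents:
  fixes p q :: int
  assumes "coprime p q" "0 < p" "p < q"
  obtains p1 q1 p2 q2 where "p = p1 + p2" "q = q1 + q2" "0 < q1" "0 < q2" "0 \<le> p1" "p2 \<le> q2"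
    "p2 * q1 - p1 * q2 = 1"
proof -
  obtain u v where "u * p + v * q = 1"
    using bezout_int[of p q] assms(1) by auto
  moreover define q1 where "q1 = u mod q"
  \<comment> \<open>This is \<open>(p * q1 - 1) / q\<close>, written without division.\<close>
  moreover define p1 where "p1 = - v - p * (u div q)"
  moreover have "u = q * (u div q) + u mod q" by simp
  ultimately have "u * p = 1 - v * q" "q1 = u - q * (u div q)" "p1 = - v - p * (u div q)" by linarith+
  then have p1: "p * q1 - 1 = q * p1" by algebra
  have "q1 \<noteq> 0"
  proof
    assume "q1 = 0"
    then have "q dvd 1" using p1 by (metis dvd_minus_iff dvd_triv_left diff_0 mult_zero_right)
    then show False using assms by simp
  qed
  then have q1: "0 < q1" "q1 < q" using assms pos_mod_sign[of q u] pos_mod_bound[of q u] by (auto simp: q1_def order_less_le simp del: pos_mod_sign pos_mod_bound)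
  show ?thesis
  proof (rule that[of p1 "p - p1" q1 "q - q1"])
    have "0 < p * q1" using assms q1 by simp
    then have "0 \<le> q * p1" using p1 by linarith
    then show "0 \<le> p1" using assms by (simp add: zero_le_mult_iff)
    \<comment> \<open>After multiplication by \<open>q\<close>, the bound
      \<open>p \<le> q - 1\<close> saves \<open>q - q1 \<ge> 1\<close>, which absorbs the extra
      \<open>1\<close>.\<close>
    have "(p - p1) * q = p * (q - q1) + 1" using p1 by (simp add: algebra_simps)
    also have "\<dots> \<le> (q - 1) * (q - q1) + 1"
      using assms q1 by (intro add_right_mono mult_right_mono) auto
    also have "\<dots> \<le> (q - q1) * q" using q1 by (simp add: algebra_simps)
    finally show "p - p1 \<le> q - q1" using assms by simp
    show "(p - p1) * q1 - p1 * (q - q1) = 1" using p1 by (simp add: algebra_simps)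
  qed (use q1 in auto)
qed

lemma coprime_of_det:
  fixes p q p' q' :: int
  assumes "p' * q - p * q' = 1"
  shows "coprime p q" "coprime p' q'"
proof -
  show "coprime p q"
    by (rule coprimeI) (metis assms dvd_diff dvd_mult dvd_mult2)
  show "coprime p' q'"
    by (rule coprimeI) (metis assms dvd_diff dvd_mult dvd_mult2)
qed

text \<open>Both parents of a fraction have smaller denominators, so the mediant rule propagates
  agreement from \<open>0\<close> and \<open>1\<close>.\<close>

lemma question_mark_agree_rational:
  fixes p q :: int
  assumes f: "is_question_mark f" and g: "is_question_mark g"
    and "coprime p q" "0 < q" "0 \<le> p" "p \<le> q"
  shows "f (of_int p / of_int q) = g (of_int p / of_int q)"
  using assms(3-)
proof (induction "nat q" arbitrary: p q rule: less_induct)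
  case less
  consider "p = 0" | "p = q" | "0 < p" "p < q" using less.prems by linarith
  then show ?case
  proof cases
    case 1
    then show ?thesis using f g by (simp add: is_question_mark_def)
  next
    case 2
    then show ?thesis using f g less.prems by (simp add: is_question_mark_def)
  next
    case 3
    then obtain p1 q1 p2 q2 where h: "p = p1 + p2" "q = q1 + q2" "0 < q1" "0 < q2" "0 \<le> p1"
      "p2 \<le> q2" and det: "p2 * q1 - p1 * q2 = 1"
      using farey_parents less.prems(1) by metis
    have cop: "coprime p1 q1" "coprime p2 q2" using coprime_of_det[OF det] .
    have "p2 * q1 \<le> q2 * q1" using h by (intro mult_right_mono) auto
    then have "p1 * q2 < q1 * q2" using det by (simp add: mult.commute)
    then have "p1 \<le> q1" using h by simp
    have "0 \<le> p1 * q2" using h by simp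
    then have "0 < p2 * q1" using det by linarith
    then have "0 \<le> p2" using h by (simp add: zero_less_mult_iff)
    have "f (of_int p1 / of_int q1) = g (of_int p1 / of_int q1)"
      using h cop \<open>p1 \<le> q1\<close> by (intro less.hyps) auto
    moreover have "f (of_int p2 / of_int q2) = g (of_int p2 / of_int q2)"
      using h cop \<open>0 \<le> p2\<close> by (intro less.hyps) auto
    moreover have "F (of_int p / of_int q) = (F (of_int p1 / of_int q1) + F (of_int p2 / of_int q2)) / 2"
      if "is_question_mark F" for F
      using that h cop det unfolding is_question_mark_def by blast
    ultimately show ?thesis using f g by metis
  qed
qed

lemma question_mark_unique:
  assumes f: "is_question_mark f" and g: "is_question_mark g"
  shows "f = g"
proof (rule extensionalityI[of _ "{0..1}"])
  show "f \<in> extensional {0..1}" "g \<in> extensional {0..1}"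
    using f g by (auto simp: is_question_mark_def PiE_def)
next
  fix x :: real assume x: "x \<in> {0..1}"
  \<comment> \<open>Rationals within \<open>1 / (n + 1)\<close> below \<open>x\<close>; rounding
    down keeps them in the unit interval.\<close>
  define r where "r n = of_int \<lfloor>x * real (Suc n)\<rfloor> / real (Suc n)" for n
  have r: "r n \<in> {0..1}" "f (r n) = g (r n)" for n
  proof -
    \<comment> \<open>A copy of type \<open>rat\<close>, from which \<open>quotient_of\<close>
      extracts lowest terms.\<close>
    define s where "s = of_int \<lfloor>x * real (Suc n)\<rfloor> / (of_nat (Suc n) :: rat)"
    have rs: "r n = of_rat s"
      by (simp add: r_def s_def of_rat_divide of_rat_add)
    have "of_int \<lfloor>x * real (Suc n)\<rfloor> \<le> x * real (Suc n)" by simp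
    also have "\<dots> \<le> 1 * real (Suc n)" using x by (intro mult_right_mono) auto
    finally show r01: "r n \<in> {0..1}"
      using x unfolding r_def by (auto simp: divide_le_eq zero_le_divide_iff)
    obtain p q where pq: "quotient_of s = (p, q)" by (cases "quotient_of s")
    have "0 < q" "coprime p q" and s: "s = of_int p / of_int q"
      using quotient_of_denom_pos[OF pq] quotient_of_coprime[OF pq] quotient_of_div[OF pq] by auto
    have rpq: "r n = of_int p / of_int q" by (simp add: rs s of_rat_divide)
    then have "0 \<le> p" "p \<le> q" using r01 \<open>0 < q\<close>
      by (auto simp: zero_le_divide_iff divide_le_eq)
    then show "f (r n) = g (r n)"
      using question_mark_agree_rational[OF f g] \<open>0 < q\<close> \<open>coprime p q\<close> rpq by simp
  qed
  have rx: "r \<longlonglongrightarrow> x"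
  proof (rule real_tendsto_sandwich)
    show "\<forall>\<^sub>F n in sequentially. x - 1 / real (Suc n) \<le> r n"
    proof (intro always_eventually allI)
      fix n
      have "x * real (Suc n) - 1 \<le> of_int \<lfloor>x * real (Suc n)\<rfloor>" by linarith
      then have "(x * real (Suc n) - 1) / real (Suc n) \<le> r n"
        unfolding r_def by (rule divide_right_mono) simp
      then show "x - 1 / real (Suc n) \<le> r n" by (simp add: diff_divide_distrib)
    qed
    show "\<forall>\<^sub>F n in sequentially. r n \<le> x"
      unfolding r_def by (intro always_eventually allI) (simp add: divide_le_eq)
    show "(\<lambda>n. x - 1 / real (Suc n)) \<longlonglongrightarrow> x"
      using tendsto_diff[OF tendsto_const LIMSEQ_inverse_real_of_nat, of x]
      by (simp add: inverse_eq_divide)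
  qed auto
  have "(\<lambda>n. F (r n)) \<longlonglongrightarrow> F x" if "is_question_mark F" for F
    using that rx x r(1) unfolding is_question_mark_def
    by (intro continuous_on_tendsto_compose[of "{0..1}" F]) auto
  from this[OF f] this[OF g] show "f x = g x"
    using r(2) LIMSEQ_unique by simp
qed

lemma question_mark_eq_farey_limit: "x \<in> {0..1} \<Longrightarrow> question_mark x = farey_limit x"
proof -
  have "question_mark = restrict farey_limit {0..1}"
    unfolding question_mark_def
    using is_question_mark_farey_limit question_mark_unique by blast
  then show "x \<in> {0..1} \<Longrightarrow> question_mark x = farey_limit x" by (metis restrict_apply')
qed

section \<open>Backward continued fractions\<close>

text \<open>Partial sums of the series started at entry \<open>i\<close>, in Horner form so that the
  recursion runs parallel to that of \<open>bcf_tail\<close>.\<close>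

fun bcf_sum :: "(nat \<Rightarrow> int) \<Rightarrow> nat \<Rightarrow> nat \<Rightarrow> real" where
  "bcf_sum a i 0 = 0"
| "bcf_sum a i (Suc n) = 2 powi (1 - a i) * (1 + bcf_sum a (Suc i) n)"

lemma bcf_sum_eq:
  "bcf_sum a i n = (\<Sum>j<n. 1 / 2 powi (- int (Suc j) + (\<Sum>k=i..i+j. a k)))"
proof (induction n arbitrary: i)
  case 0
  show ?case by simp
next
  case (Suc n)
  \<comment> \<open>Prepending \<open>a i\<close> raises each exponent by \<open>a i - 1\<close>;
    the \<open>-1\<close> accounts for the shift of \<open>j\<close>.\<close>
  have "(2::real) powi (1 - a i) * (1 / 2 powi (- int (Suc j) + (\<Sum>k=Suc i..Suc i+j. a k))) =
      1 / 2 powi (- int (Suc (Suc j)) + (\<Sum>k=i..i+Suc j. a k))" for j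
  proof -
    have "(\<Sum>k=i..i+Suc j. a k) = a i + (\<Sum>k=Suc i..Suc i+j. a k)"
      by (subst sum.atLeast_Suc_atMost) auto
    then have "- int (Suc (Suc j)) + (\<Sum>k=i..i+Suc j. a k) =
        (a i - 1) + (- int (Suc j) + (\<Sum>k=Suc i..Suc i+j. a k))" by simp
    then show ?thesis
      by (simp only:) (simp add: power_int_add power_int_diff)
  qed
  then show ?case
    unfolding bcf_sum.simps Suc.IH sum.lessThan_Suc_shift distrib_left sum_distrib_left
    by (simp only:) (simp add: power_int_diff)
qed

text \<open>The strict upper bound is what keeps the next denominator above
  \<open>1\<close>.\<close>

lemma bcf_tail_bounds:
  assumes "\<And>k. k \<ge> i \<Longrightarrow> a k \<ge> 2"
  shows "bcf_tail a i n \<in> {0..<1}"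
  using assms
proof (induction n arbitrary: i)
  case 0
  show ?case by simp
next
  case (Suc n)
  have "bcf_tail a (Suc i) n \<in> {0..<1}" using Suc.prems by (intro Suc.IH) auto
  moreover have "2 \<le> real_of_int (a i)"
    using Suc.prems[of i] by simp
  ultimately have "1 < real_of_int (a i) - bcf_tail a (Suc i) n" by auto
  then show ?case by (simp add: divide_less_eq)
qed

text \<open>With \<open>W = 1 - farey_limit\<close>, each of \<open>k\<close> right branches halves
  \<open>W\<close> and lowers the leading entry by one. At entry \<open>2\<close> the left branch
  exposes the tail and contributes \<open>(1 + W) / 2\<close>.\<close>

lemma farey_limit_block:
  assumes "t \<in> {0..<1}"
  shows "1 - farey_limit (1 - 1 / (real (Suc (Suc k)) - t)) =
    (1/2) ^ Suc k * (1 + (1 - farey_limit (1 - t)))"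
proof (induction k)
  case 0
  have "1 - 1 / (2 - t) = (1 - t) / (2 - t)" using assms by (simp add: field_simps)
  moreover have "farey_limit ((1 - t) / (2 - t)) = farey_limit (1 - t) / 2"
  proof -
    have "(1 - t) / (2 - t) \<le> 1/2" "0 \<le> (1 - t) / (2 - t)" using assms by (auto simp: field_simps)
    moreover have "(1 - t) / (2 - t) / (1 - (1 - t) / (2 - t)) = 1 - t"
      using assms by (simp add: field_simps)
    ultimately show ?thesis using farey_limit_left[of "(1 - t) / (2 - t)"] by metis
  qed
  ultimately show ?case by simp
next
  case (Suc k)
  define m where "m = real (Suc (Suc k)) - t"
  have m: "1 < m" using assms by (simp add: m_def)
  have m': "real (Suc (Suc (Suc k))) - t = m + 1" by (simp add: m_def)
  have "1/2 \<le> 1 - 1 / (m + 1)" "1 - 1 / (m + 1) \<le> 1" using m by (auto simp: field_simps)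
  moreover have "2 - 1 / (1 - 1 / (m + 1)) = 1 - 1 / m" using m by (simp add: field_simps)
  ultimately have "farey_limit (1 - 1 / (m + 1)) = (1 + farey_limit (1 - 1 / m)) / 2"
    using farey_limit_right[of "1 - 1 / (m + 1)"] by metis
  then have "1 - farey_limit (1 - 1 / (m + 1)) = (1 - farey_limit (1 - 1 / m)) / 2"
    by (simp add: field_simps)
  then show ?case using Suc.IH unfolding m' m_def[symmetric] by simp
qed

text \<open>The identity is exact at every depth, since the empty tail corresponds to the point
  \<open>1\<close>, of value \<open>1\<close>, and to the empty sum.\<close>

lemma farey_limit_bcf_tail:
  assumes "\<And>k. k \<ge> i \<Longrightarrow> a k \<ge> 2"
  shows "1 - farey_limit (1 - bcf_tail a i n) = bcf_sum a i n"
  using assms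
proof (induction n arbitrary: i)
  case 0
  show ?case using admissible_farey_limit by (simp add: admissible_def)
next
  case (Suc n)
  define k where "k = nat (a i - 2)"
  have ai: "a i = int (Suc (Suc k))" using Suc.prems[of i] by (simp add: k_def)
  have p: "(2::real) powi (1 - a i) = (1/2) ^ Suc k"
    by (simp add: ai power_int_minus field_simps power_int_diff power_int_add)
  have "bcf_tail a (Suc i) n \<in> {0..<1}" using Suc.prems by (intro bcf_tail_bounds) auto
  from farey_limit_block[OF this, of k] show ?case
    using Suc.IH[of "Suc i"] Suc.prems unfolding bcf_tail.simps bcf_sum.simps p
    by (simp add: ai)
qed

section \<open>Binary digits\<close>

definition bin_val :: "nat stream \<Rightarrow> real" where
  "bin_val d = (\<Sum>n. real (d !! n) / 2 ^ Suc n)"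

lemma summable_bin:
  assumes "sset d \<subseteq> {0, 1}"
  shows "summable (\<lambda>n. real (d !! n) / 2 ^ Suc n)"
proof (rule summable_comparison_test')
  show "summable (\<lambda>n. (1/2) ^ Suc n :: real)" by (simp add: summable_geometric summable_mult)
  fix n
  have "d !! n \<in> {0, 1}" using assms by (meson snth_sset subsetD)
  then show "norm (real (d !! n) / 2 ^ Suc n) \<le> (1/2) ^ Suc n"
    by (auto simp: power_divide)
qed

lemma bin_val_bounds:
  assumes "sset d \<subseteq> {0, 1}"
  shows "bin_val d \<in> {0..1}"
proof -
  have le: "real (d !! n) / 2 ^ Suc n \<le> (1/2) ^ Suc n" for n
  proof -
    have "d !! n \<in> {0, 1}" using assms by (meson snth_sset subsetD)
    then show ?thesis by (auto simp: power_divide)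
  qed
  have "bin_val d \<le> 1"
    unfolding bin_val_def
    by (rule sums_le[OF le summable_sums[OF summable_bin[OF assms]] power_half_series])
  moreover have "0 \<le> bin_val d"
    unfolding bin_val_def by (intro suminf_nonneg summable_bin assms) auto
  ultimately show ?thesis by simp
qed

lemma bin_val_SCons:
  assumes "sset d \<subseteq> {0, 1}"
  shows "bin_val (b ## d) = (real b + bin_val d) / 2"
proof -
  have "(\<lambda>n. real (d !! n) / 2 ^ Suc n / 2) sums (bin_val d / 2)"
    unfolding bin_val_def by (intro sums_divide summable_sums summable_bin assms)
  then have "(\<lambda>n. real ((b ## d) !! Suc n) / 2 ^ Suc (Suc n)) sums (bin_val d / 2)"
    by simp
  then have "(\<lambda>n. real ((b ## d) !! n) / 2 ^ Suc n) sums
      (bin_val d / 2 + real ((b ## d) !! 0) / 2 ^ Suc 0)"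
    by (rule sums_Suc)
  then show ?thesis unfolding bin_val_def[of "b ## d"] by (simp add: sums_iff add_divide_distrib)
qed

text \<open>The same affine recursion as in \<open>farey_limit_block\<close>: a leading
  \<open>1\<close> halves \<open>W = 1 - bin_val\<close>, and the closing \<open>0\<close> replaces
  \<open>W\<close> by \<open>(1 + W) / 2\<close>.\<close>

lemma bin_val_block:
  assumes "sset d \<subseteq> {0, 1}"
  shows "1 - bin_val (block k @- d) = (1/2) ^ Suc k * (1 + (1 - bin_val d))"
proof (induction k)
  case 0
  show ?case by (simp add: block_def bin_val_SCons[OF assms] field_simps)
next
  case (Suc k)
  have "sset (block k @- d) \<subseteq> {0, 1}" using assms by (auto simp: block_def)
  from bin_val_SCons[OF this, of 1]
  have "1 - bin_val (block (Suc k) @- d) = (1 - bin_val (block k @- d)) / 2"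
    by (simp add: block_def field_simps)
  then show ?case using Suc.IH by simp
qed

text \<open>A variable starting index lets inductions pass to the tail of the sequence.\<close>

definition bcf_digits_from :: "(nat \<Rightarrow> int) \<Rightarrow> nat \<Rightarrow> nat stream" where
  "bcf_digits_from a i = flat (smap (\<lambda>i. block (nat (a i - 2))) (fromN i))"

lemma bcf_digits_from_unfold:
  "bcf_digits_from a i = block (nat (a i - 2)) @- bcf_digits_from a (Suc i)"
  unfolding bcf_digits_from_def
  by (subst flat_unfold) (simp_all add: block_def)

lemma sset_bcf_digits_from: "sset (bcf_digits_from a i) \<subseteq> {0, 1}"
  unfolding bcf_digits_from_def
  by (subst sset_flat) (auto simp: block_def stream.set_map)

text \<open>Both quantities obey the same affine recursion, so each entry scales their difference by
  \<open>(1/2) ^ Suc k\<close>, at most \<open>1/2\<close>. Initially it is at most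
  \<open>1\<close>.\<close>

lemma bin_val_bcf_digits_from:
  assumes "\<And>k. k \<ge> i \<Longrightarrow> a k \<ge> 2"
  shows "\<bar>1 - bin_val (bcf_digits_from a i) - bcf_sum a i n\<bar> \<le> (1/2) ^ n"
  using assms
proof (induction n arbitrary: i)
  case 0
  then show ?case using bin_val_bounds[OF sset_bcf_digits_from, of a i] by simp
next
  case (Suc n)
  define k where "k = nat (a i - 2)"
  have ai: "a i = int (Suc (Suc k))" using Suc.prems[of i] by (simp add: k_def)
  have p: "(2::real) powi (1 - a i) = (1/2) ^ Suc k"
    by (simp add: ai power_int_minus field_simps power_int_diff power_int_add)
  have "1 - bin_val (bcf_digits_from a i) - bcf_sum a i (Suc n) =
      (1/2) ^ Suc k * (1 - bin_val (bcf_digits_from a (Suc i)) - bcf_sum a (Suc i) n)"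
    unfolding bcf_sum.simps p bcf_digits_from_unfold[of a i] k_def[symmetric]
      bin_val_block[OF sset_bcf_digits_from] right_diff_distrib[symmetric] by simp
  moreover have "\<bar>1 - bin_val (bcf_digits_from a (Suc i)) - bcf_sum a (Suc i) n\<bar> \<le> (1/2) ^ n"
    using Suc.prems by (intro Suc.IH) auto
  then have "(1/2) ^ Suc k * \<bar>1 - bin_val (bcf_digits_from a (Suc i)) - bcf_sum a (Suc i) n\<bar>
      \<le> (1/2) ^ Suc 0 * (1/2::real) ^ n"
    by (intro mult_mono power_decreasing) auto
  ultimately show ?case by (simp only: abs_mult) simp
qed

section \<open>Passage to the limit along the truncations\<close>

theorem proposition6p4:
  fixes x :: real and a :: "nat \<Rightarrow> int"
  assumes "x \<in> {0..<1}"
    and "has_bcf_expansion x a"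
  shows "summable (\<lambda>j. 1 / (2::real) powi (- int (Suc j) + (\<Sum>i=1..Suc j. a i))) \<and>
         question_mark x = 1 - (\<Sum>j. 1 / (2::real) powi (- int (Suc j) + (\<Sum>i=1..Suc j. a i))) \<and>
         has_binary_expansion (question_mark x) (bcf_digits a)"
proof -
  let ?t = "\<lambda>j. 1 / (2::real) powi (- int (Suc j) + (\<Sum>i=1..Suc j. a i))"
  have a: "\<And>k. k \<ge> 1 \<Longrightarrow> a k \<ge> 2" and lim: "bcf_truncation a \<longlonglongrightarrow> x"
    using assms(2) by (auto simp: has_bcf_expansion_def)
  have trunc: "bcf_truncation a n \<in> {0..1}" for n
    using bcf_tail_bounds[of 1 a n] a by (auto simp: bcf_truncation_def)
  have "(\<lambda>n. farey_limit (bcf_truncation a n)) \<longlonglongrightarrow> farey_limit x"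
    using admissible_farey_limit lim assms(1) trunc unfolding admissible_def
    by (intro continuous_on_tendsto_compose[of "{0..1}" farey_limit]) auto
  then have "(\<lambda>n. 1 - farey_limit (bcf_truncation a n)) \<longlonglongrightarrow> 1 - farey_limit x"
    by (intro tendsto_intros)
  \<comment> \<open>The values at the truncations are exactly the partial sums.\<close>
  then have sum_lim: "bcf_sum a 1 \<longlonglongrightarrow> 1 - question_mark x"
    using farey_limit_bcf_tail[of 1 a] a assms(1)
    by (simp add: bcf_truncation_def question_mark_eq_farey_limit)
  moreover have "bcf_sum a 1 = (\<lambda>n. \<Sum>j<n. ?t j)"
    by (rule ext) (simp add: bcf_sum_eq)
  ultimately have sums: "?t sums (1 - question_mark x)"
    by (simp add: sums_def)
  \<comment> \<open>The partial sums also converge to \<open>1\<close> minus the value of the digit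
    stream, so uniqueness of limits identifies that value with
    \<open>question_mark x\<close>.\<close>
  have "(\<lambda>n. 1 - bin_val (bcf_digits_from a 1) - bcf_sum a 1 n) \<longlonglongrightarrow> 0"
    by (rule Lim_null_comparison[where g = "\<lambda>n. (1/2) ^ n"])
       (use bin_val_bcf_digits_from[of 1 a] a in \<open>auto intro!: LIMSEQ_realpow_zero\<close>)
  moreover have "(\<lambda>n. 1 - bin_val (bcf_digits_from a 1) - bcf_sum a 1 n) \<longlonglongrightarrow>
      1 - bin_val (bcf_digits_from a 1) - (1 - question_mark x)"
    by (intro tendsto_intros sum_lim)
  ultimately have "question_mark x = bin_val (bcf_digits_from a 1)"
    using LIMSEQ_unique by fastforce
  moreover have "bcf_digits a = bcf_digits_from a 1"
    by (simp add: bcf_digits_def bcf_digits_from_def)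
  ultimately have "has_binary_expansion (question_mark x) (bcf_digits a)"
    using sset_bcf_digits_from[of a 1] summable_sums[OF summable_bin, of "bcf_digits_from a 1"]
    by (simp add: has_binary_expansion_def bin_val_def)
  with sums show ?thesis
    by (simp add: sums_iff)
qed

end
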